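(* Let $\beta\in(1,2)$ and $\tau\in(0,0.5)$, and let $f$ and $\Lambda_{\beta,\tau}$ be as defined in the context. The dynamical system $(\Lambda_{\beta,\tau},f)$ is topologically mixing: for all nonempty open sets $A$ and $B$ in $\Lambda_{\beta,\tau}$ (with the subspace topology) there exists an integer $N$ such that for all $n>N$, $$f^n(A)\cap B\neq\emptyset.$$
   Context: For $\beta\in(1,2)$ and $\tau\in(0,0.5)$, the map $f:[0,1]^2\to[0,1]^2$ is given by $$f(x,y)=\begin{cases}(\beta x,\ \tau y), & x\in[0,\beta^{-1}],\\ (\beta x-1,\ \tau y+(1-\tau)), & x\in(\beta^{-1},1],\end{cases}$$ and its attractor is $$\Lambda_{\beta,\tau}=\mathrm{closure}\Big(\bigcap_{i=0}^{\infty}f^i([0,1]^2)\Big).$$ *)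

theory Defs
  imports "HOL-Analysis.Analysis"
begin

abbreviation unit_square :: "(real \<times> real) set" where
  "unit_square \<equiv> {0..1} \<times> {0..1}"

text \<open>
  The map is total on the plane; only its values on the unit square, which it maps into itself
  for the parameters considered, are relevant.
\<close>

definition skew_map :: "real \<Rightarrow> real \<Rightarrow> real \<times> real \<Rightarrow> real \<times> real" where
  "skew_map \<beta> \<tau> = (\<lambda>(x, y).
     if x \<le> inverse \<beta> then (\<beta> * x, \<tau> * y)
     else (\<beta> * x - 1, \<tau> * y + (1 - \<tau>)))"

definition attractor :: "real \<Rightarrow> real \<Rightarrow> (real \<times> real) set" where
  "attractor \<beta> \<tau> = closure (\<Inter>i::nat. (skew_map \<beta> \<tau> ^^ i) ` unit_square)"

text \<open>Continuity of \<^term>\<open>f\<close> is not required: the map above is discontinuous.\<close>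

definition topologically_mixing :: "'a topology \<Rightarrow> ('a \<Rightarrow> 'a) \<Rightarrow> bool" where
  "topologically_mixing X f \<longleftrightarrow>
     (\<forall>A B. openin X A \<and> A \<noteq> {} \<and> openin X B \<and> B \<noteq> {} \<longrightarrow>
        (\<exists>N::nat. \<forall>n>N. (f ^^ n) ` A \<inter> B \<noteq> {}))"

end

(* Write D for the intersection of the images of the square, so that the attractor is the closure
   of D.  Inverse branches only translate and shrink the first coordinate, so with (x, y) the set D
   contains the whole horizontal segment from (0, y) to (x, y), its left end possibly excepted.
   Hence every nonempty open set meets D in a horizontal segment.  Under the beta-transformation the
   base of the segment expands until it straddles the discontinuity; its image then contains a
   right neighbourhood of the fixed point 0, which expands to (0,1].  A point of the target
   set is f^m(u, v) with u > 0; the segment reaches the vertical line through (u, v), and m further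
   steps contract this line by tau^m. *)
theory Submission
  imports Defs
begin

section \<open>Projection to the first coordinate and vertical contraction\<close>

definition beta_map :: "real \<Rightarrow> real \<Rightarrow> real" where
  "beta_map \<beta> x = (if x \<le> inverse \<beta> then \<beta> * x else \<beta> * x - 1)"

text \<open>Kept apart from its closure because its forward invariance and its preimages of every
  order come without continuity of \<open>skew_map\<close>.\<close>

definition core :: "real \<Rightarrow> real \<Rightarrow> (real \<times> real) set" where
  "core \<beta> \<tau> = (\<Inter>i. (skew_map \<beta> \<tau> ^^ i) ` unit_square)"

lemma attractor_eq_closure_core: "attractor \<beta> \<tau> = closure (core \<beta> \<tau>)"
  by (simp add: attractor_def core_def)

lemma fst_skew_map: "fst (skew_map \<beta> \<tau> p) = beta_map \<beta> (fst p)"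
  by (simp add: skew_map_def beta_map_def split: prod.split)

lemma fst_skew_map_funpow: "fst ((skew_map \<beta> \<tau> ^^ n) p) = (beta_map \<beta> ^^ n) (fst p)"
  by (induction n) (simp_all add: fst_skew_map)

text \<open>The branch depends on the first coordinate only, so points on one vertical line take the
  same branches forever, and both branches have vertical slope \<open>\<tau>\<close>.\<close>

lemma snd_skew_map_funpow_diff:
  assumes "fst p = fst q"
  shows "snd ((skew_map \<beta> \<tau> ^^ n) p) - snd ((skew_map \<beta> \<tau> ^^ n) q) = \<tau> ^ n * (snd p - snd q)"
proof (induction n)
  case (Suc n)
  have step: "snd (skew_map \<beta> \<tau> p') - snd (skew_map \<beta> \<tau> q') = \<tau> * (snd p' - snd q')"
    if "fst p' = fst q'" for p' q'
    using that by (cases p'; cases q') (simp add: skew_map_def algebra_simps)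
  have "fst ((skew_map \<beta> \<tau> ^^ n) p) = fst ((skew_map \<beta> \<tau> ^^ n) q)"
    using assms by (simp add: fst_skew_map_funpow)
  from step[OF this] Suc show ?case by simp
qed simp

lemma beta_map_funpow_0: "1 < \<beta> \<Longrightarrow> (beta_map \<beta> ^^ n) 0 = 0"
  by (induction n) (simp_all add: beta_map_def)

section \<open>Expansion of intervals under the beta-transformation\<close>

context
  fixes \<beta> :: real
  assumes beta: "1 < \<beta>" "\<beta> < 2"
begin

text \<open>The first branch suffices: \<open>u / \<beta>\<close> lies on it precisely because
  \<open>u\<close> is capped by 1.\<close>

lemma beta_map_image_initial:
  assumes "0 < c"
  shows "{0<..min 1 (\<beta> * c)} \<subseteq> beta_map \<beta> ` {0<..c}"
proof
  fix u assume u: "u \<in> {0<..min 1 (\<beta> * c)}"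
  then have "u = beta_map \<beta> (u / \<beta>)" "u / \<beta> \<in> {0<..c}"
    using beta by (auto simp: beta_map_def field_simps)
  then show "u \<in> beta_map \<beta> ` {0<..c}" by blast
qed

lemma beta_map_funpow_image_initial:
  assumes "0 < c"
  shows "{0<..min 1 (\<beta> ^ n * c)} \<subseteq> (beta_map \<beta> ^^ n) ` {0<..c}"
proof (induction n)
  case (Suc n)
  \<comment> \<open>The inner cap becomes \<open>\<beta>\<close>, which exceeds 1, so the outer cap
    absorbs it.\<close>
  have "\<beta> * min 1 (\<beta> ^ n * c) = min \<beta> (\<beta> ^ Suc n * c)"
    using beta by (simp add: min_mult_distrib_left mult.assoc)
  then have "min 1 (\<beta> * min 1 (\<beta> ^ n * c)) = min 1 (\<beta> ^ Suc n * c)"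
    using beta by simp
  moreover have "0 < min 1 (\<beta> ^ n * c)"
    using assms beta by simp
  ultimately have "{0<..min 1 (\<beta> ^ Suc n * c)} \<subseteq> beta_map \<beta> ` {0<..min 1 (\<beta> ^ n * c)}"
    using beta_map_image_initial by metis
  also have "\<dots> \<subseteq> beta_map \<beta> ` (beta_map \<beta> ^^ n) ` {0<..c}"
    using Suc by blast
  finally show ?case by (simp add: image_comp)
qed auto

text \<open>An interval inside one branch is stretched affinely; if the discontinuity is interior,
  the part to its right lands on an interval starting at 0. Intervals are open on the left and
  closed on the right since \<open>inverse \<beta>\<close> belongs to the first branch.\<close>

lemma beta_map_image_interval:
  assumes "0 \<le> a" "a < b" "b \<le> 1"
  shows "(\<exists>c>0. {0<..c} \<subseteq> beta_map \<beta> ` {a<..b}) \<or>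
    (\<exists>a' b'. 0 \<le> a' \<and> b' - a' = \<beta> * (b - a) \<and> b' \<le> 1 \<and> {a'<..b'} \<subseteq> beta_map \<beta> ` {a<..b})"
proof -
  consider "b \<le> inverse \<beta>" | "inverse \<beta> \<le> a" | "a < inverse \<beta>" "inverse \<beta> < b"
    by linarith
  then show ?thesis
  proof cases
    case 1
    have "{\<beta> * a<..\<beta> * b} \<subseteq> beta_map \<beta> ` {a<..b}"
    proof
      fix u assume u: "u \<in> {\<beta> * a<..\<beta> * b}"
      then have v: "u / \<beta> \<in> {a<..b}" using beta by (auto simp: field_simps)
      then have "u / \<beta> \<le> inverse \<beta>" using 1 by simp
      then have "u = beta_map \<beta> (u / \<beta>)" using beta by (simp add: beta_map_def)
      with v show "u \<in> beta_map \<beta> ` {a<..b}" by blast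
    qed
    moreover have "0 \<le> \<beta> * a" "\<beta> * b \<le> 1" "\<beta> * b - \<beta> * a = \<beta> * (b - a)"
      using 1 assms beta by (auto simp: field_simps)
    ultimately show ?thesis by blast
  next
    case 2
    have "{\<beta> * a - 1<..\<beta> * b - 1} \<subseteq> beta_map \<beta> ` {a<..b}"
    proof
      fix u assume u: "u \<in> {\<beta> * a - 1<..\<beta> * b - 1}"
      then have v: "(u + 1) / \<beta> \<in> {a<..b}" using beta by (auto simp: field_simps)
      then have "\<not> (u + 1) / \<beta> \<le> inverse \<beta>" using 2 by simp
      then have "u = beta_map \<beta> ((u + 1) / \<beta>)" using beta by (simp add: beta_map_def)
      with v show "u \<in> beta_map \<beta> ` {a<..b}" by blast
    qed
    moreover have "0 \<le> \<beta> * a - 1" using 2 beta by (simp add: field_simps)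
    \<comment> \<open>\<open>\<beta> < 2\<close> keeps the image of the second branch below
      1.\<close>
    moreover have "\<beta> * b \<le> \<beta> * 1" using assms beta by (intro mult_left_mono) auto
    then have "\<beta> * b - 1 \<le> 1" using beta by linarith
    moreover have "\<beta> * b - 1 - (\<beta> * a - 1) = \<beta> * (b - a)" by (simp add: algebra_simps)
    ultimately show ?thesis by blast
  next
    case 3
    have "{0<..\<beta> * b - 1} \<subseteq> beta_map \<beta> ` {a<..b}"
    proof
      fix u assume u: "u \<in> {0<..\<beta> * b - 1}"
      then have w: "inverse \<beta> < (u + 1) / \<beta>" "(u + 1) / \<beta> \<le> b"
        using beta by (auto simp: field_simps)
      then have v: "(u + 1) / \<beta> \<in> {a<..b}" using 3 by simp
      have "u = beta_map \<beta> ((u + 1) / \<beta>)" using beta w by (simp add: beta_map_def)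
      with v show "u \<in> beta_map \<beta> ` {a<..b}" by blast
    qed
    moreover have "0 < \<beta> * b - 1" using 3 beta by (simp add: field_simps)
    ultimately show ?thesis by blast
  qed
qed

text \<open>The dichotomy is iterated. The time \<open>n\<close> in the first alternative is not
  tied to \<open>k\<close>, so once that alternative holds it persists; until then each step
  multiplies the length by \<open>\<beta>\<close>.\<close>

lemma beta_map_funpow_image_interval:
  assumes "0 \<le> a" "a < b" "b \<le> 1"
  shows "(\<exists>n. \<exists>c>0. {0<..c} \<subseteq> (beta_map \<beta> ^^ n) ` {a<..b}) \<or>
    (\<exists>a' b'. 0 \<le> a' \<and> b' - a' = \<beta> ^ k * (b - a) \<and> b' \<le> 1 \<and>
       {a'<..b'} \<subseteq> (beta_map \<beta> ^^ k) ` {a<..b})"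
proof (induction k)
  case 0
  have "0 \<le> a \<and> b - a = \<beta> ^ 0 * (b - a) \<and> b \<le> 1 \<and> {a<..b} \<subseteq> (beta_map \<beta> ^^ 0) ` {a<..b}"
    using assms by simp
  then show ?case by blast
next
  case (Suc k)
  then show ?case
  proof (elim disjE)
    assume "\<exists>a' b'. 0 \<le> a' \<and> b' - a' = \<beta> ^ k * (b - a) \<and> b' \<le> 1 \<and>
       {a'<..b'} \<subseteq> (beta_map \<beta> ^^ k) ` {a<..b}"
    then obtain a' b' where *: "0 \<le> a'" "b' - a' = \<beta> ^ k * (b - a)" "b' \<le> 1"
       "{a'<..b'} \<subseteq> (beta_map \<beta> ^^ k) ` {a<..b}" by blast
    have "0 < \<beta> ^ k * (b - a)" using assms beta by simp
    then have "a' < b'" using * by linarith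
    have "beta_map \<beta> ` {a'<..b'} \<subseteq> beta_map \<beta> ` (beta_map \<beta> ^^ k) ` {a<..b}"
      using *(4) by (rule image_mono)
    also have "\<dots> = (beta_map \<beta> ^^ Suc k) ` {a<..b}" by (simp add: image_comp)
    finally have sub: "beta_map \<beta> ` {a'<..b'} \<subseteq> (beta_map \<beta> ^^ Suc k) ` {a<..b}" .
    have len: "\<beta> * (b' - a') = \<beta> ^ Suc k * (b - a)" using * by simp
    show ?thesis
      using beta_map_image_interval[OF *(1) \<open>a' < b'\<close> *(3)] sub unfolding len
      by (meson order_trans)
  qed blast
qed

text \<open>A stretched interval inside \<open>{0..1}\<close> cannot be longer than 1, so an
  interval starting at 0 must appear; it grows until it covers \<open>{0<..1}\<close>, and its later
  images still do.\<close>

lemma beta_map_exact: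
  assumes "0 \<le> a" "a < b" "b \<le> 1"
  shows "\<exists>N. \<forall>n\<ge>N. {0<..1} \<subseteq> (beta_map \<beta> ^^ n) ` {a<..b}"
proof -
  \<comment> \<open>At time \<open>k\<close> the stretched length would exceed 1, which rules out
    the second alternative.\<close>
  obtain k where k: "1 / (b - a) < \<beta> ^ k"
    using real_arch_pow beta by blast
  then have "1 < \<beta> ^ k * (b - a)"
    using assms by (simp add: field_simps)
  then obtain n c where c: "0 < c" "{0<..c} \<subseteq> (beta_map \<beta> ^^ n) ` {a<..b}"
    using beta_map_funpow_image_interval[OF assms, of k] by force
  obtain j where j: "1 / c < \<beta> ^ j"
    using real_arch_pow beta by blast
  have "{0<..1} \<subseteq> (beta_map \<beta> ^^ m) ` {a<..b}" if "m \<ge> j + n" for m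
  proof -
    define i where "i = m - n"
    with that have i: "m = i + n" "i \<ge> j" by auto
    have "\<beta> ^ j \<le> \<beta> ^ i" using beta i by (simp add: power_increasing)
    with j have "1 / c < \<beta> ^ i" by linarith
    then have "min 1 (\<beta> ^ i * c) = 1"
      using c by (simp add: field_simps)
    then have "{0<..1} \<subseteq> (beta_map \<beta> ^^ i) ` {0<..c}"
      using beta_map_funpow_image_initial[OF c(1), of i] by simp
    also have "\<dots> \<subseteq> (beta_map \<beta> ^^ i) ` (beta_map \<beta> ^^ n) ` {a<..b}"
      using c by blast
    also have "\<dots> = (beta_map \<beta> ^^ m) ` {a<..b}"
      by (simp add: i funpow_add image_comp)
    finally show ?thesis .
  qed
  then show ?thesis by blast
qed

section \<open>The core of the attractor and its horizontal segments\<close>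

context
  fixes \<tau> :: real
  assumes tau: "0 < \<tau>" "\<tau> < 1"
begin

lemma skew_map_unit_square: "skew_map \<beta> \<tau> ` unit_square \<subseteq> unit_square"
proof
  fix p assume "p \<in> skew_map \<beta> \<tau> ` unit_square"
  then obtain x y where xy: "0 \<le> x" "x \<le> 1" "0 \<le> y" "y \<le> 1" "p = skew_map \<beta> \<tau> (x, y)"
    by auto
  have "\<beta> * x \<le> \<beta> * 1" "\<tau> * y \<le> \<tau> * 1" "0 \<le> \<tau> * y" "0 \<le> \<beta> * x"
    using xy beta tau by (auto intro: mult_left_mono)
  then have bounds: "\<beta> * x \<le> 2" "\<tau> * y \<le> 1" "0 \<le> \<tau> * y" "0 \<le> \<beta> * x"
    using beta tau by linarith+
  have "\<beta> * x \<le> 1 \<longleftrightarrow> x \<le> inverse \<beta>"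
    using beta by (simp add: field_simps)
  then show "p \<in> unit_square"
    using bounds xy(4) tau by (cases "x \<le> inverse \<beta>") (simp_all add: xy(5) skew_map_def)
qed

lemma core_subset_unit_square: "core \<beta> \<tau> \<subseteq> unit_square"
proof -
  have "core \<beta> \<tau> \<subseteq> (skew_map \<beta> \<tau> ^^ 0) ` unit_square"
    unfolding core_def by blast
  then show ?thesis by simp
qed

text \<open>Applying the map raises the index of each image by one; index 0 is covered by invariance
  of the square.\<close>

lemma skew_map_core: "p \<in> core \<beta> \<tau> \<Longrightarrow> skew_map \<beta> \<tau> p \<in> core \<beta> \<tau>"
proof -
  assume p: "p \<in> core \<beta> \<tau>"
  have "skew_map \<beta> \<tau> p \<in> (skew_map \<beta> \<tau> ^^ i) ` unit_square" for i
  proof (cases i)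
    case 0
    then show ?thesis using p core_subset_unit_square skew_map_unit_square by auto
  next
    case (Suc j)
    have "p \<in> (skew_map \<beta> \<tau> ^^ j) ` unit_square" using p by (auto simp: core_def)
    then show ?thesis by (auto simp: Suc)
  qed
  then show ?thesis by (simp add: core_def)
qed

lemma skew_map_funpow_core: "p \<in> core \<beta> \<tau> \<Longrightarrow> (skew_map \<beta> \<tau> ^^ n) p \<in> core \<beta> \<tau>"
  by (induction n) (simp_all add: skew_map_core)

(* A point with x = 0 has only preimages with x = 0, on the first branch, whence the second case. *)
lemma skew_map_funpow_image_horizontal:
  assumes "(x, y) \<in> (skew_map \<beta> \<tau> ^^ i) ` unit_square"
    and "0 < x' \<and> x' \<le> x \<or> x = 0 \<and> 0 \<le> x' \<and> x' \<le> 1"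
  shows "(x', y) \<in> (skew_map \<beta> \<tau> ^^ i) ` unit_square"
  using assms
proof (induction i arbitrary: x y x')
  case 0
  then show ?case by auto
next
  case (Suc i)
  then obtain z w where zw: "(z, w) \<in> (skew_map \<beta> \<tau> ^^ i) ` unit_square"
      "(x, y) = skew_map \<beta> \<tau> (z, w)"
    by (metis (no_types, lifting) funpow.simps(2) image_comp imageE surj_pair)
  \<comment> \<open>The witness is the preimage of \<open>x'\<close> under the branch used by
    \<open>z\<close>; it stands to \<open>z\<close> as \<open>x'\<close> stands to \<open>x\<close>,
    so the induction hypothesis applies at height \<open>w\<close>.\<close>
  have "\<exists>z'. (z', w) \<in> (skew_map \<beta> \<tau> ^^ i) ` unit_square \<and> skew_map \<beta> \<tau> (z', w) = (x', y)"
  proof (cases "z \<le> inverse \<beta>")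
    case True
    then have eq: "x = \<beta> * z" "y = \<tau> * w" using zw by (auto simp: skew_map_def)
    have "\<beta> * z \<le> 1" using True beta by (simp add: field_simps)
    then have x': "x' \<le> 1" using Suc.prems(2) eq by auto
    have "0 < x' / \<beta> \<and> x' / \<beta> \<le> z \<or> z = 0 \<and> 0 \<le> x' / \<beta> \<and> x' / \<beta> \<le> 1"
      using Suc.prems(2) beta x' by (auto simp: eq field_simps)
    then have "(x' / \<beta>, w) \<in> (skew_map \<beta> \<tau> ^^ i) ` unit_square"
      using Suc.IH zw by blast
    moreover have "skew_map \<beta> \<tau> (x' / \<beta>, w) = (x', y)"
      using x' beta by (simp add: skew_map_def eq field_simps)
    ultimately show ?thesis by blast
  next
    case False
    then have eq: "x = \<beta> * z - 1" "y = \<tau> * w + (1 - \<tau>)" using zw by (auto simp: skew_map_def)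
    have "0 < x" using False beta by (simp add: eq field_simps)
    then have x': "0 < x'" "x' \<le> x" using Suc.prems(2) by auto
    have "0 < (x' + 1) / \<beta> \<and> (x' + 1) / \<beta> \<le> z"
      using x' beta by (auto simp: eq field_simps)
    then have "((x' + 1) / \<beta>, w) \<in> (skew_map \<beta> \<tau> ^^ i) ` unit_square"
      using Suc.IH zw by blast
    \<comment> \<open>Strict because \<open>0 < x'\<close>. For \<open>x' = 0\<close> the candidate
      would be \<open>inverse \<beta>\<close>, which follows the first branch instead.\<close>
    moreover have "inverse \<beta> < (x' + 1) / \<beta>"
      using x' beta by (simp add: field_simps)
    then have "skew_map \<beta> \<tau> ((x' + 1) / \<beta>, w) = (x', y)"
      using beta by (simp add: skew_map_def eq)
    ultimately show ?thesis by blast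
  qed
  then show ?case by (metis funpow.simps(2) image_comp image_eqI)
qed

lemma core_horizontal:
  assumes "(x, y) \<in> core \<beta> \<tau>" "0 < x' \<and> x' \<le> x \<or> x = 0 \<and> 0 \<le> x' \<and> x' \<le> 1"
  shows "(x', y) \<in> core \<beta> \<tau>"
  using skew_map_funpow_image_horizontal[OF _ assms(2)] assms(1) by (simp add: core_def)

text \<open>An open set meeting the closure of the core meets the core itself. From a point there,
  \<open>core_horizontal\<close> supplies points to the left, or to the right if the first
  coordinate is 0.\<close>

lemma open_attractor_contains_segment:
  assumes "openin (top_of_set (attractor \<beta> \<tau>)) A" "A \<noteq> {}"
  obtains a b y where "0 \<le> a" "a < b" "b \<le> 1" "{a<..b} \<times> {y} \<subseteq> A \<inter> core \<beta> \<tau>"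
proof -
  obtain U where U: "open U" "A = attractor \<beta> \<tau> \<inter> U"
    using assms(1) by (auto simp: openin_open)
  have "U \<inter> core \<beta> \<tau> \<noteq> {}"
    using assms(2) U open_Int_closure_eq_empty[OF U(1), of "core \<beta> \<tau>"] unfolding attractor_eq_closure_core by blast
  then obtain x y where xy: "(x, y) \<in> U" "(x, y) \<in> core \<beta> \<tau>" by auto
  then have x: "0 \<le> x" "x \<le> 1" using core_subset_unit_square by auto
  obtain e where e: "0 < e" "ball (x, y) e \<subseteq> U"
    using U(1) xy(1) openE by blast
  have near: "(x', y) \<in> A" if "(x', y) \<in> core \<beta> \<tau>" "\<bar>x' - x\<bar> < e" for x'
  proof -
    have "(x', y) \<in> ball (x, y) e" using that(2) by (simp add: dist_Pair_Pair dist_real_def)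
    then show ?thesis using that(1) e(2) closure_subset U(2) attractor_eq_closure_core by blast
  qed
  show thesis
  proof (cases "x = 0")
    case True
    \<comment> \<open>Half the radius, because the closed right end must itself lie at distance less
      than \<open>e\<close>.\<close>
    define b where "b = min 1 (e / 2)"
    have b: "0 < b" "b \<le> 1" "b < e" using e by (auto simp: b_def)
    have "(x', y) \<in> A \<inter> core \<beta> \<tau>" if "x' \<in> {0<..b}" for x'
      using core_horizontal[OF xy(2), of x'] near[of x'] that True b by auto
    then have "{0<..b} \<times> {y} \<subseteq> A \<inter> core \<beta> \<tau>" by blast
    then show thesis using that[of 0 b y] b by simp
  next
    case False
    \<comment> \<open>Truncation at 0 makes \<open>x'\<close> positive, as
      \<open>core_horizontal\<close> requires.\<close>
    define a where "a = max 0 (x - e)"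
    have a: "0 \<le> a" "a < x" using x False e by (auto simp: a_def)
    have "(x', y) \<in> A \<inter> core \<beta> \<tau>" if "x' \<in> {a<..x}" for x'
      using core_horizontal[OF xy(2), of x'] near[of x'] that by (auto simp: a_def)
    then have "{a<..x} \<times> {y} \<subseteq> A \<inter> core \<beta> \<tau>" by blast
    then show thesis using that[of a x y] a x by simp
  qed
qed

section \<open>Mixing on the attractor\<close>

lemma skew_map_mixing: "topologically_mixing (top_of_set (attractor \<beta> \<tau>)) (skew_map \<beta> \<tau>)"
  unfolding topologically_mixing_def
proof (intro allI impI, elim conjE)
  fix A B
  assume A: "openin (top_of_set (attractor \<beta> \<tau>)) A" "A \<noteq> {}"
    and B: "openin (top_of_set (attractor \<beta> \<tau>)) B" "B \<noteq> {}"
  let ?f = "skew_map \<beta> \<tau>"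
  obtain a b y where ab: "0 \<le> a" "a < b" "b \<le> 1" "{a<..b} \<times> {y} \<subseteq> A \<inter> core \<beta> \<tau>"
    using open_attractor_contains_segment[OF A] .
  obtain c d v where cd: "0 \<le> c" "c < d" "d \<le> 1" "{c<..d} \<times> {v} \<subseteq> B \<inter> core \<beta> \<tau>"
    using open_attractor_contains_segment[OF B] .
  \<comment> \<open>The right end of the segment is a target with positive first coordinate.\<close>
  have q: "(d, v) \<in> B" "(d, v) \<in> core \<beta> \<tau>" "0 < d" using cd by auto
  obtain U where U: "open U" "B = attractor \<beta> \<tau> \<inter> U"
    using B(1) by (auto simp: openin_open)
  obtain e where e: "0 < e" "ball (d, v) e \<subseteq> U"
    using U q(1) openE by blast
  obtain m where m: "\<tau> ^ m < e"
    using real_arch_pow_inv[OF e(1) tau(2)] by blast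
  \<comment> \<open>This preimage only has to lie in the square: it records branches that lead to
    \<open>(d, v)\<close> in \<open>m\<close> steps.\<close>
  have "(d, v) \<in> (?f ^^ m) ` unit_square"
    using q(2) by (simp add: core_def)
  then obtain z where z: "(d, v) = (?f ^^ m) z" "z \<in> unit_square"
    by (rule imageE)
  obtain s t where "z = (s, t)" by (cases z)
  with z have st: "(s, t) \<in> unit_square" "(?f ^^ m) (s, t) = (d, v)" by auto
  have s_iter: "(beta_map \<beta> ^^ m) s = d"
    using fst_skew_map_funpow[of m \<beta> \<tau> "(s, t)"] st(2) by simp
  \<comment> \<open>0 is fixed by \<open>beta_map\<close>, but the orbit of \<open>s\<close> reaches
    \<open>d > 0\<close>.\<close>
  then have "s \<noteq> 0" using q(3) beta_map_funpow_0[OF beta(1), of m] by auto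
  then have s: "s \<in> {0<..1}" using st(1) by auto
  obtain N where N: "\<And>n. n \<ge> N \<Longrightarrow> {0<..1} \<subseteq> (beta_map \<beta> ^^ n) ` {a<..b}"
    using beta_map_exact[OF ab(1-3)] by blast
  have "(?f ^^ n) ` A \<inter> B \<noteq> {}" if n: "n > N + m" for n
  proof -
    \<comment> \<open>The first \<open>k\<close> steps bring a point of \<open>A\<close> onto the
      vertical line through \<open>(s, t)\<close>; the last \<open>m\<close> steps shadow the orbit
      of \<open>(s, t)\<close>.\<close>
    define k where "k = n - m"
    with n have k: "n = m + k" "k \<ge> N" by auto
    obtain x where x: "x \<in> {a<..b}" "(beta_map \<beta> ^^ k) x = s"
      using N[OF k(2)] s by blast
    have xA: "(x, y) \<in> A" "(x, y) \<in> core \<beta> \<tau>" using ab x by auto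
    define p where "p = (?f ^^ k) (x, y)"
    have p: "p \<in> core \<beta> \<tau>" "fst p = s"
      using xA x by (auto simp: p_def skew_map_funpow_core fst_skew_map_funpow)
    have pn: "(?f ^^ n) (x, y) = (?f ^^ m) p" by (simp add: p_def k funpow_add)
    have "snd p \<in> {0..1}" "t \<in> {0..1}"
      using p(1) core_subset_unit_square st(1) by auto
    \<comment> \<open>Heights in the square differ by at most 1, so the choice of \<open>m\<close>
      works for every \<open>p\<close>, hence for every \<open>n\<close>.\<close>
    then have "\<bar>snd p - t\<bar> \<le> 1" by auto
    then have "\<tau> ^ m * \<bar>snd p - t\<bar> \<le> \<tau> ^ m" using tau by (intro mult_left_le) auto
    with m have "\<tau> ^ m * \<bar>snd p - t\<bar> < e" by linarith
    moreover have "snd ((?f ^^ m) p) - v = \<tau> ^ m * (snd p - t)"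
      using snd_skew_map_funpow_diff[of p "(s, t)" m \<beta> \<tau>] p(2) st(2) by simp
    ultimately have "\<bar>snd ((?f ^^ m) p) - v\<bar> < e"
      using tau by (simp add: abs_mult)
    \<comment> \<open>The first coordinate is hit exactly, so the distance to \<open>(d, v)\<close>
      is purely vertical.\<close>
    moreover have "fst ((?f ^^ m) p) = d" by (simp add: fst_skew_map_funpow p(2) s_iter)
    ultimately have "(?f ^^ m) p \<in> ball (d, v) e"
      by (cases "(?f ^^ m) p") (simp add: dist_Pair_Pair dist_real_def abs_minus_commute)
    moreover have "(?f ^^ m) p \<in> attractor \<beta> \<tau>"
      using skew_map_funpow_core[OF p(1), of m] closure_subset
      unfolding attractor_eq_closure_core by blast
    ultimately have "(?f ^^ n) (x, y) \<in> B" using U(2) e(2) pn by auto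
    then show ?thesis using xA(1) by blast
  qed
  then show "\<exists>N. \<forall>n>N. (?f ^^ n) ` A \<inter> B \<noteq> {}" by blast
qed

end

end

theorem theorem2p1:
  fixes \<beta> \<tau> :: real
  assumes "\<beta> \<in> {1<..<2}" and "\<tau> \<in> {0<..<1/2}"
  shows "topologically_mixing (top_of_set (attractor \<beta> \<tau>)) (skew_map \<beta> \<tau>)"
  using assms by (intro skew_map_mixing) auto

end
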